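(* Let $p,q\ge 1$, $n=p+q$, and let $s\in Q$, i.e. $s\in\mathrm{SL}(n,\mathbb{C})$ with $s^\dagger=s$. Then $s$ is admissible (that is, $s\in Q_{\mathrm{adm}}$) if and only if all eigenvalues of $s$ are real and positive and $s$ maps the closure of the timelike cone into the timelike cone plus the origin, i.e. $s(\mathbb{C}^n_+\cup\mathbb{C}^n_0)\subset \mathbb{C}^n_+\cup\{0\}$.
   Context: Let $p,q$ be positive integers and $n=p+q$. Equip $\mathbb{C}^n$ with the sesquilinear pairing $\langle \mathbf{x},\mathbf{y}\rangle=\sum_{i=1}^p x_i\bar y_i-\sum_{j=p+1}^n x_j\bar y_j$. A vector $\mathbf{x}$ is timelike if $\langle\mathbf{x},\mathbf{x}\rangle>0$. The timelike cone is $\mathbb{C}^n_+=\{\mathbf{x}:\langle\mathbf{x},\mathbf{x}\rangle>0\}$ and the nullcone is $\mathbb{C}^n_0=\{\mathbf{x}:\langle\mathbf{x},\mathbf{x}\rangle=0\}$ (which contains $0$). $G_0=\mathrm{SU}(p,q)$ is the subgroup of $G=\mathrm{SL}(n,\mathbb{C})$ preserving this pairing. Let $J_{p,q}=\mathrm{diag}(1,\dots,1,-1,\dots,-1)$ ($p$ ones followed by $q$ minus ones), and for an $n\times n$ complex matrix $M$ let $M^\dagger=J_{p,q}M^*J_{p,q}$, where $M^*$ is the conjugate transpose. Let $\mathfrak{q}=\{X\in\mathfrak{sl}(n,\mathbb{C}):X^\dagger=X\}$ and $Q=\{s\in G: s^\dagger=s\}$. Let $\mathfrak{a}$ be the space of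 real diagonal $n\times n$ matrices of trace zero. An element $\mathrm{diag}(\lambda_1,\dots,\lambda_p,\mu_1,\dots,\mu_q)\in\mathfrak{a}$ is admissible if $\lambda_i>\mu_j$ for all $i,j$. An element $X\in\mathfrak{q}$ is admissible if it is $G_0$-conjugate to an admissible element of $\mathfrak{a}$; the set of these is $\mathfrak{q}_{\mathrm{adm}}$. The set of admissible elements of $Q$ is $Q_{\mathrm{adm}}=\exp(\mathfrak{q}_{\mathrm{adm}})$. *)

theory Defs
  imports Complex_Main "Jordan_Normal_Form.Schur_Decomposition" "Jordan_Normal_Form.Char_Poly"
begin

text \<open>
  Indices are shifted to start at 0: the positive directions of the form are
  \<open>i < p\<close>, the negative ones are \<open>p \<le> i < p + q\<close>.
\<close>

definition pairing :: "nat \<Rightarrow> nat \<Rightarrow> complex vec \<Rightarrow> complex vec \<Rightarrow> complex" where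
  "pairing p q x y = (\<Sum>i = 0..<p. x $ i * cnj (y $ i)) - (\<Sum>j = p..<p + q. x $ j * cnj (y $ j))"

text \<open>
  The order on \<^typ>\<open>complex\<close> is the one of \<^theory>\<open>HOL-Library.Complex_Order\<close>:
  \<open>0 < z\<close> means that \<open>z\<close> is a positive real number. As \<open>pairing p q x x\<close> is always real,
  this is the usual reading of \<open>\<langle>x,x\<rangle> > 0\<close>.
\<close>

definition timelike_cone :: "nat \<Rightarrow> nat \<Rightarrow> complex vec set" where
  "timelike_cone p q = {x \<in> carrier_vec (p + q). 0 < pairing p q x x}"

definition nullcone :: "nat \<Rightarrow> nat \<Rightarrow> complex vec set" where
  "nullcone p q = {x \<in> carrier_vec (p + q). pairing p q x x = 0}"

definition SL :: "nat \<Rightarrow> complex mat set" where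
  "SL n = {g \<in> carrier_mat n n. det g = 1}"

definition SU :: "nat \<Rightarrow> nat \<Rightarrow> complex mat set" where
  "SU p q = {g \<in> SL (p + q).
     \<forall>x \<in> carrier_vec (p + q). \<forall>y \<in> carrier_vec (p + q).
       pairing p q (g *\<^sub>v x) (g *\<^sub>v y) = pairing p q x y}"

definition sl :: "nat \<Rightarrow> complex mat set" where
  "sl n = {X \<in> carrier_mat n n. (\<Sum>i = 0..<n. X $$ (i, i)) = 0}"

definition J_mat :: "nat \<Rightarrow> nat \<Rightarrow> complex mat" where
  "J_mat p q = mat_diag (p + q) (\<lambda>i. if i < p then 1 else - 1)"

text \<open>\<^const>\<open>mat_adjoint\<close> is the conjugate transpose.\<close>

definition dagger :: "nat \<Rightarrow> nat \<Rightarrow> complex mat \<Rightarrow> complex mat" where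
  "dagger p q M = J_mat p q * mat_adjoint M * J_mat p q"

definition q_space :: "nat \<Rightarrow> nat \<Rightarrow> complex mat set" where
  "q_space p q = {X \<in> sl (p + q). dagger p q X = X}"

definition Q_space :: "nat \<Rightarrow> nat \<Rightarrow> complex mat set" where
  "Q_space p q = {s \<in> SL (p + q). dagger p q s = s}"

definition a_space :: "nat \<Rightarrow> complex mat set" where
  "a_space n = {mat_diag n (\<lambda>i. complex_of_real (d i)) | d :: nat \<Rightarrow> real. (\<Sum>i = 0..<n. d i) = 0}"

definition a_adm :: "nat \<Rightarrow> nat \<Rightarrow> complex mat set" where
  "a_adm p q = {D \<in> a_space (p + q).
     \<forall>i \<in> {0..<p}. \<forall>j \<in> {p..<p + q}. Re (D $$ (i, i)) > Re (D $$ (j, j))}"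

text \<open>
  \<open>similar_mat_wit X D g h\<close> states that \<open>h\<close> is the two-sided inverse of \<open>g\<close> and
  that \<open>X = g * D * h\<close>.
\<close>

definition q_adm :: "nat \<Rightarrow> nat \<Rightarrow> complex mat set" where
  "q_adm p q = {X \<in> q_space p q.
     \<exists>D \<in> a_adm p q. \<exists>g \<in> SU p q. \<exists>h. similar_mat_wit X D g h}"

text \<open>
  The exponential series, summed entrywise; for a square matrix every entry series converges.
\<close>

definition mat_exp :: "complex mat \<Rightarrow> complex mat" where
  "mat_exp A = mat (dim_row A) (dim_col A) (\<lambda>(i, j). \<Sum>k. (A ^\<^sub>m k) $$ (i, j) / fact k)"

definition Q_adm :: "nat \<Rightarrow> nat \<Rightarrow> complex mat set" where
  "Q_adm p q = mat_exp ` q_adm p q"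

end

theory Submission
  imports Defs
begin

text \<open>
  If all eigenvalues are nonzero and the cone condition holds, no eigenvector \<open>v\<close> of \<open>s\<close> is null: its image would
  be a nonzero null vector. Since \<open>s\<close> is self-adjoint for the pairing, a Gram-Schmidt process applied to a
  triangularizing basis never meets a null vector and yields an eigenbasis orthogonal for the pairing; by Sylvester's
  law of inertia it can be normalized to the columns of some \<open>g \<in> SU(p,q)\<close>, so \<open>s = g diag(c) g\<^sup>-\<^sup>1\<close>. Applying the
  cone condition to the null vector \<open>v + w\<close>, for normalized eigenvectors \<open>v\<close>, \<open>w\<close> of opposite sign, shows that the
  eigenvalue of \<open>v\<close> exceeds that of \<open>w\<close>; hence \<open>g diag(ln c) g\<^sup>-\<^sup>1\<close> is admissible with exponential \<open>s\<close>.
  Conversely, if \<open>s = g diag(exp d) g\<^sup>-\<^sup>1\<close> with \<open>t\<close> strictly between the \<open>d\<^sub>j\<close> with \<open>j \<ge> p\<close> and the \<open>d\<^sub>i\<close> with \<open>i < p\<close>, and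
  \<open>y = g\<^sup>-\<^sup>1 x\<close>, then \<open>\<langle>sx,sx\<rangle> - exp(2t) \<langle>x,x\<rangle>\<close> is a combination of the \<open>\<bar>y\<^sub>i\<bar>\<^sup>2\<close> with positive coefficients.
\<close>

section \<open>The pairing\<close>

text \<open>The real diagonal of \<open>J_mat\<close>; it turns the two sums of
  \<open>pairing\<close> into one weighted sum over all indices.\<close>

definition sig :: "nat \<Rightarrow> nat \<Rightarrow> real" where
  "sig p i = (if i < p then 1 else - 1)"

lemma sig_simps [simp]:
  "i < p \<Longrightarrow> sig p i = 1" "\<not> i < p \<Longrightarrow> sig p i = - 1" "sig p i * sig p i = 1" "sig p i \<noteq> 0"
  by (auto simp: sig_def)

lemma sum_sig:
  fixes f :: "nat \<Rightarrow> 'a :: real_algebra_1"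
  shows "(\<Sum>i<p + q. of_real (sig p i) * f i) = (\<Sum>i = 0..<p. f i) - (\<Sum>j = p..<p + q. f j)"
proof -
  have "{..<p + q} = {0..<p} \<union> {p..<p + q}" by auto
  then show ?thesis
    by (simp add: sum.union_disjoint ivl_disj_int sum_negf)
qed

lemma pairing_sig:
  "pairing p q x y = (\<Sum>i<p + q. of_real (sig p i) * (x $ i * cnj (y $ i)))"
  unfolding pairing_def sum_sig ..

text \<open>Exhibits the value as a real number, so that sign conditions in the complex order become
  real inequalities.\<close>

lemma pairing_self:
  "pairing p q x x = of_real (\<Sum>i<p + q. sig p i * (cmod (x $ i))\<^sup>2)"
  by (simp add: pairing_sig complex_norm_square[symmetric] flip: of_real_power)

lemma pairing_commute: "pairing p q y x = cnj (pairing p q x y)"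
  by (simp add: pairing_sig mult.commute)

lemma pairing_diff_left:
  assumes "x \<in> carrier_vec (p + q)" "y \<in> carrier_vec (p + q)"
  shows "pairing p q (x - y) z = pairing p q x z - pairing p q y z"
  using assms by (simp add: pairing_sig algebra_simps sum_subtractf)

lemma pairing_add_left:
  assumes "x \<in> carrier_vec (p + q)" "y \<in> carrier_vec (p + q)"
  shows "pairing p q (x + y) z = pairing p q x z + pairing p q y z"
  using assms by (simp add: pairing_sig algebra_simps sum.distrib)

lemma pairing_smult_left:
  assumes "x \<in> carrier_vec (p + q)"
  shows "pairing p q (a \<cdot>\<^sub>v x) z = a * pairing p q x z"
  using assms by (simp add: pairing_sig sum_distrib_left mult_ac)

lemma pairing_add_right:
  assumes "x \<in> carrier_vec (p + q)" "y \<in> carrier_vec (p + q)"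
  shows "pairing p q z (x + y) = pairing p q z x + pairing p q z y"
  using assms by (simp add: pairing_sig algebra_simps sum.distrib)

lemma pairing_smult_right:
  assumes "x \<in> carrier_vec (p + q)"
  shows "pairing p q z (a \<cdot>\<^sub>v x) = cnj a * pairing p q z x"
  using assms by (simp add: pairing_sig sum_distrib_left mult_ac)

lemma pairing_unit_left:
  assumes "i < p + q"
  shows "pairing p q (unit_vec (p + q) i) y = of_real (sig p i) * cnj (y $ i)"
proof -
  have "of_real (sig p j) * (unit_vec (p + q) i $ j * cnj (y $ j)) =
      (if j = i then of_real (sig p i) * cnj (y $ i) else 0)" if "j < p + q" for j
    using that assms by (auto simp: unit_vec_def)
  then show ?thesis
    using assms by (simp add: pairing_sig)
qed

lemma pairing_unit_right:
  assumes "i < p + q"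
  shows "pairing p q x (unit_vec (p + q) i) = of_real (sig p i) * x $ i"
  using pairing_commute[of p q x "unit_vec (p + q) i"] pairing_unit_left[OF assms, of x] by simp

lemma mult_mat_vec_nth:
  assumes "M \<in> carrier_mat n m" "x \<in> carrier_vec m" "i < n"
  shows "(M *\<^sub>v x) $ i = (\<Sum>j<m. M $$ (i, j) * x $ j)"
  using assms by (auto simp: scalar_prod_def atLeast0LessThan)

lemma mult_mat_vec_unit:
  fixes M :: "'a :: semiring_1 mat"
  assumes "M \<in> carrier_mat n m" "j < m"
  shows "M *\<^sub>v unit_vec m j = col M j"
  using assms by (intro eq_vecI) auto

text \<open>Multiplying by the sign matrix on both sides scales the entry at \<open>(i, j)\<close>
  by \<open>sig p i * sig p j\<close>, so the equation can be compared entry by entry.\<close>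

lemma dagger_eq_iff:
  assumes M: "M \<in> carrier_mat (p + q) (p + q)"
  shows "dagger p q M = M \<longleftrightarrow> (\<forall>i<p + q. \<forall>j<p + q.
           M $$ (i, j) = of_real (sig p i * sig p j) * cnj (M $$ (j, i)))"
proof -
  have adj: "mat_adjoint M \<in> carrier_mat (p + q) (p + q)"
    using M by (auto simp: mat_adjoint_def)
  have ent: "mat_adjoint M $$ (i, j) = cnj (M $$ (j, i))" if "i < p + q" "j < p + q" for i j
    using M that by (auto simp: mat_adjoint_def mat_of_rows_def)
  have J: "J_mat p q = mat_diag (p + q) (\<lambda>i. of_real (sig p i))"
    by (auto simp: J_mat_def mat_diag_def)
  have "dagger p q M = mat (p + q) (p + q)
          (\<lambda>(i, j). of_real (sig p i * sig p j) * cnj (M $$ (j, i)))"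
    unfolding dagger_def J using adj
    by (subst mat_diag_mult_left[OF adj], subst mat_diag_mult_right[of _ "p + q"])
       (auto simp: ent)
  moreover have "mat (p + q) (p + q) f = M \<longleftrightarrow> (\<forall>i<p + q. \<forall>j<p + q. M $$ (i, j) = f (i, j))" for f
    using M unfolding mat_eq_iff by (metis carrier_matD dim_row_mat(1) dim_col_mat(1) index_mat(1))
  ultimately show ?thesis by simp
qed

text \<open>Both sides say that \<open>J M\<close> equals the conjugate transpose of
  \<open>M\<close> times \<open>J\<close>. Testing on pairs of unit vectors recovers the
  entries.\<close>

lemma pairing_selfadjoint_iff:
  assumes M: "M \<in> carrier_mat (p + q) (p + q)"
  shows "dagger p q M = M \<longleftrightarrow> (\<forall>x\<in>carrier_vec (p + q). \<forall>y\<in>carrier_vec (p + q).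
           pairing p q (M *\<^sub>v x) y = pairing p q x (M *\<^sub>v y))"
proof
  assume "dagger p q M = M"
  then have M_ij: "of_real (sig p i) * M $$ (i, j) = of_real (sig p j) * cnj (M $$ (j, i))"
    if "i < p + q" "j < p + q" for i j
  proof -
    have "M $$ (i, j) = of_real (sig p i * sig p j) * cnj (M $$ (j, i))"
      using \<open>dagger p q M = M\<close> that unfolding dagger_eq_iff[OF M] by blast
    \<comment> \<open>Multiplying by \<open>sig p i\<close>, whose square is 1, moves that sign to
      the left.\<close>
    then have "of_real (sig p i) * M $$ (i, j) =
        of_real (sig p i) * (of_real (sig p i * sig p j) * cnj (M $$ (j, i)))"
      by (rule arg_cong)
    also have "\<dots> = of_real (sig p j) * cnj (M $$ (j, i))"
      by (simp only: mult.assoc[symmetric] of_real_mult[symmetric] sig_simps of_real_1 mult_1_left)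
    finally show ?thesis .
  qed
  show "\<forall>x\<in>carrier_vec (p + q). \<forall>y\<in>carrier_vec (p + q).
          pairing p q (M *\<^sub>v x) y = pairing p q x (M *\<^sub>v y)"
  proof (intro ballI)
    fix x y :: "complex vec"
    assume x: "x \<in> carrier_vec (p + q)" and y: "y \<in> carrier_vec (p + q)"
    have "pairing p q (M *\<^sub>v x) y =
        (\<Sum>i<p + q. \<Sum>j<p + q. (of_real (sig p i) * M $$ (i, j)) * (x $ j * cnj (y $ i)))"
      unfolding pairing_sig
      by (rule sum.cong) (simp_all add: mult_mat_vec_nth[OF M x] sum_distrib_left sum_distrib_right mult_ac)
    also have "\<dots> =
        (\<Sum>i<p + q. \<Sum>j<p + q. (of_real (sig p j) * cnj (M $$ (j, i))) * (x $ j * cnj (y $ i)))"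
      by (intro sum.cong refl) (simp add: M_ij)
    also have "\<dots> = pairing p q x (M *\<^sub>v y)"
      unfolding pairing_sig
      by (subst sum.swap, rule sum.cong)
         (simp_all add: mult_mat_vec_nth[OF M y] sum_distrib_left sum_distrib_right mult_ac)
    finally show "pairing p q (M *\<^sub>v x) y = pairing p q x (M *\<^sub>v y)" .
  qed
next
  assume R: "\<forall>x\<in>carrier_vec (p + q). \<forall>y\<in>carrier_vec (p + q).
          pairing p q (M *\<^sub>v x) y = pairing p q x (M *\<^sub>v y)"
  show "dagger p q M = M"
    unfolding dagger_eq_iff[OF M]
  proof (intro allI impI)
    fix i j assume ij: "i < p + q" "j < p + q"
    have "pairing p q (M *\<^sub>v unit_vec (p + q) j) (unit_vec (p + q) i) =
          pairing p q (unit_vec (p + q) j) (M *\<^sub>v unit_vec (p + q) i)"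
      using R by auto
    then have "of_real (sig p i) * M $$ (i, j) = of_real (sig p j) * cnj (M $$ (j, i))"
      using ij M by (simp add: mult_mat_vec_unit[OF M] pairing_unit_left pairing_unit_right)
    then have "of_real (sig p i) * (of_real (sig p i) * M $$ (i, j)) =
        of_real (sig p i) * (of_real (sig p j) * cnj (M $$ (j, i)))" by (rule arg_cong)
    then show "M $$ (i, j) = of_real (sig p i * sig p j) * cnj (M $$ (j, i))"
      by (simp only: mult.assoc[symmetric] of_real_mult[symmetric] sig_simps of_real_1 mult_1_left)
  qed
qed

section \<open>Orthogonal eigenbases of triangular matrices\<close>

text \<open>
  Gram-Schmidt along the flag \<open>S k\<close> spanned by the first \<open>k\<close> unit vectors. If \<open>u\<close> is the part of the next unit
  vector orthogonal to the flag, then \<open>B u - B\<^sub>k\<^sub>k u\<close> lies in \<open>S k\<close> by triangularity and is orthogonal to \<open>S k\<close> by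
  self-adjointness, hence vanishes: \<open>u\<close> is again an eigenvector, and therefore non-null, so the form stays
  nondegenerate on the next step of the flag.
\<close>

lemma triangular_selfadjoint_eigenbasis:
  fixes B :: "complex mat" and F :: "complex vec \<Rightarrow> complex vec \<Rightarrow> complex"
  assumes B: "B \<in> carrier_mat n n" "upper_triangular B"
    and diff: "\<And>x y z. x \<in> carrier_vec n \<Longrightarrow> y \<in> carrier_vec n \<Longrightarrow> z \<in> carrier_vec n \<Longrightarrow>
                 F (x - y) z = F x z - F y z"
    and smult: "\<And>a x z. x \<in> carrier_vec n \<Longrightarrow> z \<in> carrier_vec n \<Longrightarrow> F (a \<cdot>\<^sub>v x) z = a * F x z"
    and herm: "\<And>x y. x \<in> carrier_vec n \<Longrightarrow> y \<in> carrier_vec n \<Longrightarrow> F y x = cnj (F x y)"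
    and selfadj: "\<And>x y. x \<in> carrier_vec n \<Longrightarrow> y \<in> carrier_vec n \<Longrightarrow> F (B *\<^sub>v x) y = F x (B *\<^sub>v y)"
    and nonnull: "\<And>v c. eigenvector B v c \<Longrightarrow> F v v \<noteq> 0"
  shows "\<exists>v. (\<forall>i<n. eigenvector B (v i) (B $$ (i, i))) \<and> (\<forall>i<n. \<forall>j<n. i \<noteq> j \<longrightarrow> F (v i) (v j) = 0)"
proof -
  define S :: "nat \<Rightarrow> complex vec set" where "S k = {y \<in> carrier_vec n. \<forall>j. k \<le> j \<longrightarrow> j < n \<longrightarrow> y $ j = 0}" for k
  have S_carrier: "y \<in> carrier_vec n" if "y \<in> S k" for y k
    using that by (simp add: S_def)
  have S_mono: "y \<in> S (Suc k)" if "y \<in> S k" for y k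
    using that by (simp add: S_def)
  have S_diff: "x - y \<in> S k" if "x \<in> S k" "y \<in> S k" for x y :: "complex vec" and k
    using that by (auto simp: S_def)
  have S_add: "x + y \<in> S k" if "x \<in> S k" "y \<in> S k" for x y :: "complex vec" and k
    using that by (auto simp: S_def)
  have S_smult: "a \<cdot>\<^sub>v x \<in> S k" if "x \<in> S k" for a :: complex and x k
    using that by (auto simp: S_def)
  have S_unit: "unit_vec n k \<in> S (Suc k)" for k
    by (auto simp: S_def)
  have S_pred: "x - (x $ k / y $ k) \<cdot>\<^sub>v y \<in> S k"
    if "x \<in> S (Suc k)" "y \<in> S (Suc k)" "y $ k \<noteq> 0" for x y :: "complex vec" and k
  proof -
    from that(1,2) have xy: "x \<in> carrier_vec n" "y \<in> carrier_vec n"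
      by (auto intro: S_carrier)
    have zero: "x $ j = 0" "y $ j = 0" if "k < j" "j < n" for j
      using that \<open>x \<in> S (Suc k)\<close> \<open>y \<in> S (Suc k)\<close> by (simp_all add: S_def)
    have "(x - (x $ k / y $ k) \<cdot>\<^sub>v y) $ j = 0" if "k \<le> j" "j < n" for j
      using that xy zero[of j] \<open>y $ k \<noteq> 0\<close> by (cases "j = k") simp_all
    moreover have "x - (x $ k / y $ k) \<cdot>\<^sub>v y \<in> carrier_vec n" using xy by simp
    ultimately show ?thesis
      unfolding S_def by blast
  qed
  have S_mult: "B *\<^sub>v x - B $$ (k, k) \<cdot>\<^sub>v x \<in> S k" if x: "x \<in> S (Suc k)" and k: "k < n" for x k
  proof -
    have xc: "x \<in> carrier_vec n" using x by (rule S_carrier)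
    have xj: "x $ j = 0" if "k < j" "j < n" for j
      using x that by (simp add: S_def)
    have Bjl: "B $$ (j, l) = 0" if "l < j" "j < n" for j l
      using B that by (simp add: upper_triangular_def)
    have "(B *\<^sub>v x) $ j = B $$ (k, k) * x $ j" if j: "k \<le> j" "j < n" for j
    proof -
      \<comment> \<open>For \<open>l < k\<close> the matrix entry lies below the diagonal; for
        \<open>l > k\<close> the coordinate of \<open>x\<close> vanishes.\<close>
      have "B $$ (j, l) * x $ l = (if l = k then B $$ (j, k) * x $ k else 0)" if "l < n" for l
      proof (cases "l < k")
        case True
        then show ?thesis using Bjl[of l j] j by simp
      next
        case False
        then show ?thesis using xj[of l] that by simp
      qed
      then have "(\<Sum>l<n. B $$ (j, l) * x $ l) = (\<Sum>l<n. if l = k then B $$ (j, k) * x $ k else 0)"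
        by (intro sum.cong) simp_all
      then have "(B *\<^sub>v x) $ j = B $$ (j, k) * x $ k"
        using k j(2) by (simp add: mult_mat_vec_nth[OF B(1) xc] del: index_mult_mat_vec)
      then show ?thesis
        using xj[of j] Bjl[of k j] j by (cases "j = k") simp_all
    qed
    then show ?thesis
      using B xc by (simp add: S_def del: index_mult_mat_vec)
  qed
  have F_diff_right: "F x (y - z) = F x y - F x z"
    if "x \<in> carrier_vec n" "y \<in> carrier_vec n" "z \<in> carrier_vec n" for x y z
    using that herm[of "y - z" x] herm[of y x] herm[of z x] by (simp add: diff)
  have F_smult_right: "F x (a \<cdot>\<^sub>v y) = cnj a * F x y"
    if "x \<in> carrier_vec n" "y \<in> carrier_vec n" for x y a
    using that herm[of "a \<cdot>\<^sub>v y" x] herm[of y x] by (simp add: smult)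
  \<comment> \<open>The last two conjuncts take the place of spans and dimension counts: every
    vector has a projection to \<open>S k\<close>, and only zero in \<open>S k\<close> is orthogonal
    to all \<open>v i\<close>.\<close>
  have "\<exists>v. (\<forall>i<k. v i \<in> S k \<and> eigenvector B (v i) (B $$ (i, i))) \<and>
          (\<forall>i<k. \<forall>j<k. i \<noteq> j \<longrightarrow> F (v i) (v j) = 0) \<and>
          (\<forall>y\<in>carrier_vec n. \<exists>w\<in>S k. \<forall>i<k. F (y - w) (v i) = 0) \<and>
          (\<forall>w\<in>S k. (\<forall>i<k. F w (v i) = 0) \<longrightarrow> w = 0\<^sub>v n)" (is "\<exists>v. ?P k v")
    if "k \<le> n" for k
    using that
  proof (induction k)
    case 0
    have "0\<^sub>v n \<in> S 0" by (simp add: S_def)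
    moreover have "w = 0\<^sub>v n" if "w \<in> S 0" for w
      using that by (auto simp: S_def)
    ultimately show ?case by auto
  next
    case (Suc k)
    then have k: "k < n" by simp
    from Suc obtain v where v: "?P k v" by auto
    then have vc: "v i \<in> carrier_vec n" if "i < k" for i
      using that S_carrier by blast
    from v obtain w where w: "w \<in> S k" "\<forall>i<k. F (unit_vec n k - w) (v i) = 0"
      by (metis unit_vec_carrier)
    define u where "u = unit_vec n k - w"
    have uS: "u \<in> S (Suc k)"
      unfolding u_def by (intro S_diff S_unit S_mono w)
    have uc: "u \<in> carrier_vec n" using uS by (rule S_carrier)
    \<comment> \<open>Elements of \<open>S k\<close> vanish at index \<open>k\<close>, so only the
      unit vector contributes; hence \<open>u\<close> is nonzero and can eliminate coordinate
      \<open>k\<close>.\<close>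
    have uk: "u $ k = 1"
      using w(1) k by (auto simp: u_def S_def)
    have orth: "F u (v i) = 0" if "i < k" for i
      using w that by (simp add: u_def)
    have orth': "F (v i) u = 0" if "i < k" for i
      using orth[OF that] herm[OF uc vc[OF that]] by simp
    \<comment> \<open>Moving \<open>B\<close> over to the eigenvector \<open>v i\<close> only puts a
      scalar in front of \<open>F u (v i)\<close>, which is zero.\<close>
    have "F (B *\<^sub>v u - B $$ (k, k) \<cdot>\<^sub>v u) (v i) = 0" if "i < k" for i
    proof -
      have "B *\<^sub>v v i = B $$ (i, i) \<cdot>\<^sub>v v i"
        using v that by (simp add: eigenvector_def)
      then show ?thesis
        using B(1) uc vc[OF that] orth[OF that] by (simp add: diff smult selfadj F_smult_right)
    qed
    then have "B *\<^sub>v u - B $$ (k, k) \<cdot>\<^sub>v u = 0\<^sub>v n"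
      using v S_mult[OF uS k] by blast
    then have "B *\<^sub>v u = B $$ (k, k) \<cdot>\<^sub>v u"
      using B(1) uc by (simp add: vec_eq_iff)
    moreover have "u \<noteq> 0\<^sub>v n" using uk k by auto
    ultimately have ev: "eigenvector B u (B $$ (k, k))"
      using B(1) uc by (simp add: eigenvector_def)
    from nonnull[OF ev] have h: "F u u \<noteq> 0" .
    define v' where "v' = v(k := u)"
    have "\<exists>w\<in>S (Suc k). \<forall>i<Suc k. F (y - w) (v' i) = 0" if y: "y \<in> carrier_vec n" for y
    proof -
      from v y obtain w0 where w0: "w0 \<in> S k" "\<forall>i<k. F (y - w0) (v i) = 0" by blast
      \<comment> \<open>Coefficient of the projection onto \<open>u\<close>; the denominator is
        nonzero by \<open>h\<close>. Subtracting a multiple of \<open>u\<close> keeps the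
        orthogonality to the earlier \<open>v i\<close>.\<close>
      define a where "a = F (y - w0) u / F u u"
      have w0c: "w0 \<in> carrier_vec n" using w0(1) by (rule S_carrier)
      have eq: "y - (w0 + a \<cdot>\<^sub>v u) = (y - w0) - a \<cdot>\<^sub>v u"
        using y w0c uc by (auto simp: vec_eq_iff)
      have "F (y - (w0 + a \<cdot>\<^sub>v u)) (v' i) = 0" if "i < Suc k" for i
        unfolding eq using that w0(2) y w0c uc h orth[of i] vc[of i]
        by (cases "i = k") (auto simp: v'_def diff[of "y - w0"] smult a_def)
      moreover have "w0 + a \<cdot>\<^sub>v u \<in> S (Suc k)"
        by (intro S_add S_smult uS S_mono w0)
      ultimately show ?thesis by blast
    qed
    \<comment> \<open>Eliminating coordinate \<open>k\<close> with \<open>u\<close> leaves a vector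
      of \<open>S k\<close> that is zero by induction. So \<open>w\<close> is a multiple of
      \<open>u\<close>, and orthogonality to the non-null \<open>u\<close> kills the factor.\<close>
    moreover have "w = 0\<^sub>v n" if wS: "w \<in> S (Suc k)" and worth: "\<forall>i<Suc k. F w (v' i) = 0" for w
    proof -
      have wc: "w \<in> carrier_vec n" using wS by (rule S_carrier)
      have "w - (w $ k) \<cdot>\<^sub>v u \<in> S k"
        using S_pred[OF wS uS] uk by simp
      moreover have "F (w - (w $ k) \<cdot>\<^sub>v u) (v i) = 0" if "i < k" for i
        using worth[rule_format, of i] that wc uc vc[OF that] orth[OF that]
        by (simp add: diff smult v'_def)
      ultimately have "w - (w $ k) \<cdot>\<^sub>v u = 0\<^sub>v n"
        using v by blast
      then have weq: "w = (w $ k) \<cdot>\<^sub>v u"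
        using wc uc by (auto simp: vec_eq_iff)
      have "F w u = 0" using worth by (auto simp: v'_def)
      \<comment> \<open>\<open>weq\<close> has \<open>w\<close> on both sides and would loop as a
        rewrite rule, so it is applied by hand.\<close>
      moreover have "F w u = w $ k * F u u"
        using arg_cong[OF weq, of "\<lambda>x. F x u"] smult[OF uc uc] by (rule trans)
      ultimately have "w $ k = 0" using h by simp
      with weq have "w = 0 \<cdot>\<^sub>v u" by (rule subst[where P = "\<lambda>a. w = a \<cdot>\<^sub>v u", rotated])
      also have "\<dots> = 0\<^sub>v n" using uc by (auto simp: vec_eq_iff)
      finally show ?thesis .
    qed
    moreover have "\<forall>i<Suc k. v' i \<in> S (Suc k) \<and> eigenvector B (v' i) (B $$ (i, i))"
      using v uS ev S_mono by (auto simp: v'_def less_Suc_eq)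
    moreover have "\<forall>i<Suc k. \<forall>j<Suc k. i \<noteq> j \<longrightarrow> F (v' i) (v' j) = 0"
      using v orth orth' by (auto simp: v'_def less_Suc_eq)
    ultimately have "?P (Suc k) v'" by blast
    then show ?case by blast
  qed
  from this[of n] show ?thesis by auto
qed

section \<open>Pairings of images via the Gram matrix of the columns\<close>

lemma pairing_mult_mat_vec:
  assumes U: "U \<in> carrier_mat (p + q) m" and x: "x \<in> carrier_vec m" and y: "y \<in> carrier_vec m"
  shows "pairing p q (U *\<^sub>v x) (U *\<^sub>v y) =
    (\<Sum>i<m. \<Sum>j<m. x $ i * cnj (y $ j) * pairing p q (col U i) (col U j))"
proof -
  have "pairing p q (U *\<^sub>v x) (U *\<^sub>v y) = (\<Sum>r<p + q. \<Sum>i<m. \<Sum>j<m.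
      of_real (sig p r) * (U $$ (r, i) * x $ i * cnj (U $$ (r, j) * y $ j)))"
    unfolding pairing_sig
    by (intro sum.cong refl)
       (simp only: lessThan_iff mult_mat_vec_nth[OF U x] mult_mat_vec_nth[OF U y] cnj_sum
         sum_product, simp only: sum_distrib_left)
  also have "\<dots> = (\<Sum>i<m. \<Sum>j<m. \<Sum>r<p + q.
      of_real (sig p r) * (U $$ (r, i) * x $ i * cnj (U $$ (r, j) * y $ j)))"
    by (subst sum.swap, rule sum.cong[OF refl], rule sum.swap)
  also have "\<dots> = (\<Sum>i<m. \<Sum>j<m. x $ i * cnj (y $ j) * pairing p q (col U i) (col U j))"
    using U by (intro sum.cong refl) (auto simp: pairing_sig sum_distrib_left mult_ac intro!: sum.cong)
  finally show ?thesis .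
qed

text \<open>The diagonal of the Gram matrix is left arbitrary, so this serves both unnormalized
  orthogonal families and pseudo-orthonormal columns.\<close>

lemma pairing_mult_mat_vec_orthogonal:
  assumes U: "U \<in> carrier_mat (p + q) m" and x: "x \<in> carrier_vec m" and y: "y \<in> carrier_vec m"
    and orth: "\<And>i j. i < m \<Longrightarrow> j < m \<Longrightarrow> i \<noteq> j \<Longrightarrow> pairing p q (col U i) (col U j) = 0"
  shows "pairing p q (U *\<^sub>v x) (U *\<^sub>v y) =
    (\<Sum>i<m. x $ i * cnj (y $ i) * pairing p q (col U i) (col U i))"
proof -
  have "(\<Sum>j<m. x $ i * cnj (y $ j) * pairing p q (col U i) (col U j)) =
      (\<Sum>j<m. if j = i then x $ i * cnj (y $ i) * pairing p q (col U i) (col U i) else 0)"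
    if "i < m" for i
    by (rule sum.cong) (auto simp: orth[OF that])
  then show ?thesis
    by (simp add: pairing_mult_mat_vec[OF U x y])
qed

section \<open>Sylvester's law of inertia\<close>

text \<open>A homogeneous system with fewer equations than unknowns. Padding with zero rows makes it
  square and singular, so the determinant criterion yields a kernel vector.\<close>

lemma exists_vec_orthogonal_to_few:
  fixes rs :: "'a :: idom vec list"
  assumes len: "length rs < n" and rs: "set rs \<subseteq> carrier_vec n"
  shows "\<exists>y\<in>carrier_vec n. y \<noteq> 0\<^sub>v n \<and> (\<forall>r\<in>set rs. r \<bullet> y = 0)"
proof -
  define M where "M = mat_of_rows n (rs @ replicate (n - length rs) (0\<^sub>v n))"
  have M: "M \<in> carrier_mat n n"
    using len by (simp add: M_def mat_of_rows_def)
  have MT: "M\<^sup>T \<in> carrier_mat n n" using M by simp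
  have row_M: "row M i = (if i < length rs then rs ! i else 0\<^sub>v n)" if "i < n" for i
    using that rs len nth_mem[of i rs]
    by (auto simp: M_def mat_of_rows_row nth_append simp del: nth_mem)
  \<comment> \<open>As \<open>length rs < n\<close>, row \<open>n - 1\<close> belongs to the
    padding, so the transpose kills the last unit vector.\<close>
  have n: "n - 1 < n" using len by simp
  have "M\<^sup>T *\<^sub>v unit_vec n (n - 1) = row M (n - 1)"
    using mult_mat_vec_unit[of "M\<^sup>T" n n "n - 1"] M n by simp
  also have "\<dots> = 0\<^sub>v n" using row_M[OF n] len by (simp split: if_splits)
  finally have "M\<^sup>T *\<^sub>v unit_vec n (n - 1) = 0\<^sub>v n" .
  moreover have "unit_vec n (n - 1) \<noteq> (0\<^sub>v n :: 'a vec)"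
    using n by simp
  ultimately have "det M\<^sup>T = 0"
    using det_0_iff_vec_prod_zero[OF MT] unit_vec_carrier by blast
  then have "det M = 0" using M by (simp add: det_transpose)
  then obtain y where y: "y \<in> carrier_vec n" "y \<noteq> 0\<^sub>v n" "M *\<^sub>v y = 0\<^sub>v n"
    using det_0_iff_vec_prod_zero[OF M] by auto
  have "r \<bullet> y = 0" if "r \<in> set rs" for r
  proof -
    from that obtain i where i: "i < length rs" "r = rs ! i" by (auto simp: in_set_conv_nth)
    then have "row M i \<bullet> y = (0\<^sub>v n :: 'a vec) $ i"
      using y(3) M len by (metis carrier_matD(1) index_mult_mat_vec less_trans)
    then show ?thesis using i len by (simp add: row_M)
  qed
  with y show ?thesis by blast
qed

text \<open>
  If \<open>b\<close> had more positive entries than \<open>a\<close>, some \<open>y \<noteq> 0\<close> would be supported on \<open>b > 0\<close> while \<open>U y\<close> vanishes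
  on \<open>a > 0\<close>, as this imposes fewer than \<open>n\<close> linear conditions.
\<close>

lemma sylvester_inertia_le:
  fixes a b :: "nat \<Rightarrow> real" and U :: "complex mat"
  assumes U: "U \<in> carrier_mat n n"
    and eq: "\<And>y. y \<in> carrier_vec n \<Longrightarrow>
      (\<Sum>i<n. a i * (cmod ((U *\<^sub>v y) $ i))\<^sup>2) = (\<Sum>j<n. b j * (cmod (y $ j))\<^sup>2)"
  shows "card {j\<in>{..<n}. b j > 0} \<le> card {i\<in>{..<n}. a i > 0}"
proof (rule ccontr)
  assume less: "\<not> ?thesis"
  define A where "A = {i\<in>{..<n}. a i > 0}"
  define C where "C = {j\<in>{..<n}. \<not> b j > 0}"
  have "C = {..<n} - {j\<in>{..<n}. b j > 0}" by (auto simp: C_def)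
  then have "card C = n - card {j\<in>{..<n}. b j > 0}"
    using card_Diff_subset[of "{j\<in>{..<n}. b j > 0}" "{..<n}"] by force
  moreover have "card {j\<in>{..<n}. b j > 0} \<le> n"
    using card_mono[of "{..<n}" "{j\<in>{..<n}. b j > 0}"] by auto
  ultimately have card: "card A + card C < n"
    using less by (simp add: A_def)
  \<comment> \<open>The rows of \<open>U\<close> force \<open>U y\<close> to vanish on
    \<open>A\<close>, the unit vectors force \<open>y\<close> to vanish on \<open>C\<close>.\<close>
  define rs where "rs = map (row U) (sorted_list_of_set A) @ map (unit_vec n) (sorted_list_of_set C)"
  have fin: "finite A" "finite C" by (auto simp: A_def C_def)
  have "length rs < n" using card by (simp add: rs_def)
  moreover have "set rs \<subseteq> carrier_vec n"
    using U fin by (auto simp: rs_def)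
  ultimately obtain y where y: "y \<in> carrier_vec n" "y \<noteq> 0\<^sub>v n" and rs0: "\<forall>r\<in>set rs. r \<bullet> y = 0"
    using exists_vec_orthogonal_to_few by blast
  have Uy: "(U *\<^sub>v y) $ i = 0" if "i \<in> A" for i
    using rs0 that fin U by (auto simp: rs_def A_def)
  have yC: "y $ j = 0" if "j \<in> C" for j
  proof -
    have "unit_vec n j \<bullet> y = 0" using rs0 that fin by (auto simp: rs_def)
    then show ?thesis using that y(1) by (simp add: C_def)
  qed
  have "(\<Sum>i<n. a i * (cmod ((U *\<^sub>v y) $ i))\<^sup>2) \<le> 0"
  proof (intro sum_nonpos)
    fix i assume "i \<in> {..<n}"
    then show "a i * (cmod ((U *\<^sub>v y) $ i))\<^sup>2 \<le> 0"
      using Uy[of i] by (cases "i \<in> A") (auto simp: A_def intro: mult_nonpos_nonneg)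
  qed
  moreover have "(\<Sum>j<n. b j * (cmod (y $ j))\<^sup>2) > 0"
  proof -
    from y obtain j where j: "j < n" "y $ j \<noteq> 0" by (auto simp: vec_eq_iff)
    have nonneg: "b l * (cmod (y $ l))\<^sup>2 \<ge> 0" if "l < n" for l
      using that yC[of l] by (cases "l \<in> C") (auto simp: C_def)
    have "b j > 0" using j yC[of j] by (auto simp: C_def)
    then show ?thesis
      using j nonneg by (intro sum_pos2[of _ j]) auto
  qed
  ultimately show False using eq[OF y(1)] by simp
qed

lemma card_sig_pos: "card {i\<in>{..<p + q}. sig p i > 0} = p"
  and card_sig_neg: "card {i\<in>{..<p + q}. - sig p i > 0} = q"
proof -
  have "{i\<in>{..<p + q}. sig p i > 0} = {..<p}" "{i\<in>{..<p + q}. - sig p i > 0} = {p..<p + q}"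
    by (auto simp: sig_def split: if_splits)
  then show "card {i\<in>{..<p + q}. sig p i > 0} = p" "card {i\<in>{..<p + q}. - sig p i > 0} = q"
    by simp_all
qed

text \<open>The Gram matrix of the \<open>u i\<close> is real, diagonal and without zeros on the
  diagonal. By inertia exactly \<open>p\<close> entries are positive and \<open>q\<close> negative,
  so a reordering matches their signs with \<open>sig\<close>, and a rescaling makes their moduli
  1.\<close>

lemma pseudo_orthonormal_reindex:
  assumes u: "\<And>i. i < p + q \<Longrightarrow> u i \<in> carrier_vec (p + q)"
    and orth: "\<And>i j. i < p + q \<Longrightarrow> j < p + q \<Longrightarrow> i \<noteq> j \<Longrightarrow> pairing p q (u i) (u j) = 0"
    and nonnull: "\<And>i. i < p + q \<Longrightarrow> pairing p q (u i) (u i) \<noteq> 0"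
  obtains \<pi> :: "nat \<Rightarrow> nat" and r :: "nat \<Rightarrow> complex"
  where "\<And>i. i < p + q \<Longrightarrow> \<pi> i < p + q"
    "\<And>i j. i < p + q \<Longrightarrow> j < p + q \<Longrightarrow>
       pairing p q (r i \<cdot>\<^sub>v u (\<pi> i)) (r j \<cdot>\<^sub>v u (\<pi> j)) = (if i = j then of_real (sig p i) else 0)"
proof -
  let ?n = "p + q"
  define b where "b i = Re (pairing p q (u i) (u i))" for i
  have b: "pairing p q (u i) (u i) = of_real (b i)" for i
    by (simp add: b_def pairing_self)
  have b0: "b i \<noteq> 0" if "i < ?n" for i
    using nonnull[OF that] b[of i] by auto
  define U where "U = mat ?n ?n (\<lambda>(r, i). u i $ r)"
  have U: "U \<in> carrier_mat ?n ?n" by (simp add: U_def)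
  have col_U: "col U i = u i" if "i < ?n" for i
    using that u[OF that] by (auto simp: U_def)
  \<comment> \<open>\<open>\<langle>U y, U y\<rangle>\<close> is evaluated once in standard
    coordinates and once through the columns of \<open>U\<close>.\<close>
  have eq: "(\<Sum>i<?n. sig p i * (cmod ((U *\<^sub>v y) $ i))\<^sup>2) = (\<Sum>j<?n. b j * (cmod (y $ j))\<^sup>2)"
    if y: "y \<in> carrier_vec ?n" for y
  proof -
    have "complex_of_real (\<Sum>i<?n. sig p i * (cmod ((U *\<^sub>v y) $ i))\<^sup>2) =
        (\<Sum>i<?n. y $ i * cnj (y $ i) * pairing p q (col U i) (col U i))"
      unfolding pairing_self[symmetric]
      by (rule pairing_mult_mat_vec_orthogonal[OF U y y]) (simp add: col_U orth)
    also have "\<dots> = complex_of_real (\<Sum>j<?n. b j * (cmod (y $ j))\<^sup>2)"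
      unfolding of_real_sum
      by (rule sum.cong) (simp_all add: col_U b complex_norm_square[symmetric] mult.commute flip: of_real_power)
    finally show ?thesis by (simp only: of_real_eq_iff)
  qed
  define Pos where "Pos = {j\<in>{..<?n}. b j > 0}"
  define Neg where "Neg = {j\<in>{..<?n}. - b j > 0}"
  have "card Pos \<le> p"
    using sylvester_inertia_le[OF U eq] unfolding Pos_def card_sig_pos .
  \<comment> \<open>The same bound for the negated forms. As no \<open>b i\<close> vanishes, the two
    counts add up to \<open>p + q\<close>, so both bounds are attained.\<close>
  moreover have "card Neg \<le> q"
  proof -
    have "(\<Sum>i<?n. - sig p i * (cmod ((U *\<^sub>v y) $ i))\<^sup>2) = (\<Sum>j<?n. - b j * (cmod (y $ j))\<^sup>2)"
      if "y \<in> carrier_vec ?n" for y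
      using eq[OF that] by (simp add: sum_negf)
    from sylvester_inertia_le[OF U this] show ?thesis
      unfolding Neg_def card_sig_neg .
  qed
  moreover have "card Pos + card Neg = ?n"
  proof -
    have "Pos \<union> Neg = {..<?n}" "Pos \<inter> Neg = {}" "finite Pos" "finite Neg"
      using b0 by (auto simp: Pos_def Neg_def not_less_iff_gr_or_eq)
    then show ?thesis
      using card_Un_disjoint[of Pos Neg] by simp
  qed
  ultimately have card: "card Pos = p" "card Neg = q" by auto
  have fin: "finite Pos" "finite Neg" by (auto simp: Pos_def Neg_def)
  obtain f where f: "bij_betw f {..<p} Pos"
    using fin card by (metis bij_betw_iff_card card_lessThan finite_lessThan)
  obtain g where g: "bij_betw g {p..<?n} Neg"
    using fin card by (metis add_diff_cancel_left' bij_betw_iff_card card_atLeastLessThan finite_atLeastLessThan)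
  define \<pi> where "\<pi> i = (if i < p then f i else g i)" for i
  have pos: "\<pi> i \<in> Pos" if "i < p" for i
    using f that by (auto simp: \<pi>_def bij_betw_def)
  have neg: "\<pi> i \<in> Neg" if "p \<le> i" "i < ?n" for i
    using g that by (auto simp: \<pi>_def bij_betw_def)
  have \<pi>_less: "\<pi> i < ?n" if "i < ?n" for i
    using pos[of i] neg[of i] that by (cases "i < p") (auto simp: Pos_def Neg_def)
  have \<pi>_inj: "i = j" if "i < ?n" "j < ?n" "\<pi> i = \<pi> j" for i j
  proof -
    have "i < p \<longleftrightarrow> j < p"
      using that pos[of i] neg[of i] pos[of j] neg[of j] by (force simp: Pos_def Neg_def)
    then show ?thesis
      using inj_onD[OF bij_betw_imp_inj_on[OF f], of i j] inj_onD[OF bij_betw_imp_inj_on[OF g], of i j] that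
      by (cases "i < p") (simp_all add: \<pi>_def)
  qed
  have sgn_b: "b (\<pi> i) = sig p i * \<bar>b (\<pi> i)\<bar>" if "i < ?n" for i
    using pos[of i] neg[of i] that by (cases "i < p") (auto simp: Pos_def Neg_def)
  \<comment> \<open>Then \<open>r i * cnj (r i)\<close> times \<open>b (\<pi> i)\<close> is the sign
    of \<open>b (\<pi> i)\<close>, that is, \<open>sig p i\<close>.\<close>
  define r where "r i = complex_of_real (1 / sqrt \<bar>b (\<pi> i)\<bar>)" for i
  show ?thesis
  proof
    fix i assume i: "i < ?n"
    show "\<pi> i < ?n" by (rule \<pi>_less[OF i])
  next
    fix i j assume i: "i < ?n" and j: "j < ?n"
    have eq: "pairing p q (r i \<cdot>\<^sub>v u (\<pi> i)) (r j \<cdot>\<^sub>v u (\<pi> j)) =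
        r i * cnj (r j) * pairing p q (u (\<pi> i)) (u (\<pi> j))"
      using u[OF \<pi>_less[OF i]] u[OF \<pi>_less[OF j]]
      by (simp add: pairing_smult_left pairing_smult_right)
    show "pairing p q (r i \<cdot>\<^sub>v u (\<pi> i)) (r j \<cdot>\<^sub>v u (\<pi> j)) = (if i = j then of_real (sig p i) else 0)"
    proof (cases "i = j")
      case True
      let ?b = "b (\<pi> i)"
      have "1 / sqrt \<bar>?b\<bar> * (1 / sqrt \<bar>?b\<bar>) * ?b = sig p i"
        using b0[OF \<pi>_less[OF i]] sgn_b[OF i] by (simp add: field_simps)
      then show ?thesis
        unfolding eq unfolding True[symmetric] b r_def
        by (simp only: complex_cnj_complex_of_real of_real_mult[symmetric] if_True simp_thms)
    next
      case False
      then show ?thesis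
        unfolding eq using orth[OF \<pi>_less[OF i] \<pi>_less[OF j]] \<pi>_inj[OF i j] by auto
    qed
  qed
qed

section \<open>Matrices with pseudo-orthonormal columns\<close>

lemma det_mat_diag: "det (mat_diag n f) = (\<Prod>i<n. f i)"
proof -
  have "det (mat_diag n f) = prod_list (diag_mat (mat_diag n f))"
    by (rule det_upper_triangular) (auto simp: mat_diag_def)
  also have "diag_mat (mat_diag n f) = map f [0..<n]"
    by (auto simp: diag_mat_def mat_diag_def)
  also have "prod_list \<dots> = (\<Prod>i<n. f i)"
    by (simp add: prod.distinct_set_conv_list[symmetric] atLeast0LessThan)
  finally show ?thesis .
qed

text \<open>The Gram matrix of the columns is the transpose of \<open>g\<close>, times
  \<open>J\<close>, times the conjugate of \<open>g\<close>. Taking determinants and cancelling the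
  nonzero \<open>det J\<close> leaves a determinant of modulus 1.\<close>

lemma pairing_preserved_det:
  assumes g: "g \<in> carrier_mat (p + q) (p + q)"
    and gram: "\<And>i j. i < p + q \<Longrightarrow> j < p + q \<Longrightarrow>
      pairing p q (col g i) (col g j) = (if i = j then of_real (sig p i) else 0)"
  shows "det g * cnj (det g) = 1"
proof -
  \<comment> \<open>Lets \<open>det\<close> commute with entrywise conjugation.\<close>
  interpret cnj: comm_ring_hom cnj by standard auto
  let ?n = "p + q"
  let ?J = "mat_diag ?n (\<lambda>i. complex_of_real (sig p i))"
  have gc: "map_mat cnj g \<in> carrier_mat ?n ?n" and gT: "g\<^sup>T \<in> carrier_mat ?n ?n"
    and J: "?J \<in> carrier_mat ?n ?n"
    using g by auto
  have Jg: "?J * map_mat cnj g \<in> carrier_mat ?n ?n" using J gc by (rule mult_carrier_mat)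
  have "g\<^sup>T * (?J * map_mat cnj g) = ?J"
  proof (rule eq_matI)
    fix i j assume "i < dim_row ?J" "j < dim_col ?J"
    then have ij: "i < ?n" "j < ?n" by (auto simp: mat_diag_def)
    have "(g\<^sup>T * (?J * map_mat cnj g)) $$ (i, j) =
        (\<Sum>r<?n. g $$ (r, i) * (of_real (sig p r) * cnj (g $$ (r, j))))"
      unfolding mat_diag_mult_left[OF gc]
      using g ij by (simp add: scalar_prod_def atLeast0LessThan)
    also have "\<dots> = pairing p q (col g i) (col g j)"
      unfolding pairing_sig using g ij by (intro sum.cong) auto
    finally show "(g\<^sup>T * (?J * map_mat cnj g)) $$ (i, j) = ?J $$ (i, j)"
      using ij by (auto simp: gram mat_diag_def)
  qed (use g Jg in \<open>auto simp: mat_diag_def\<close>)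
  then have "det (g\<^sup>T * (?J * map_mat cnj g)) = det ?J" by simp
  then have "det g * (det ?J * cnj (det g)) = det ?J"
    using g by (simp add: det_mult[OF gT Jg] det_mult[OF J gc] det_transpose)
  moreover have "det ?J \<noteq> 0" by (simp add: det_mat_diag)
  ultimately show ?thesis by (simp add: mult.left_commute)
qed

lemma pairing_preserved:
  assumes g: "g \<in> carrier_mat (p + q) (p + q)"
    and gram: "\<And>i j. i < p + q \<Longrightarrow> j < p + q \<Longrightarrow>
      pairing p q (col g i) (col g j) = (if i = j then of_real (sig p i) else 0)"
    and xy: "x \<in> carrier_vec (p + q)" "y \<in> carrier_vec (p + q)"
  shows "pairing p q (g *\<^sub>v x) (g *\<^sub>v y) = pairing p q x y"
proof -
  have "pairing p q (g *\<^sub>v x) (g *\<^sub>v y) =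
      (\<Sum>i<p + q. x $ i * cnj (y $ i) * pairing p q (col g i) (col g i))"
    by (rule pairing_mult_mat_vec_orthogonal[OF g xy]) (simp add: gram)
  also have "\<dots> = pairing p q x y"
  proof -
    have "(\<Sum>i<p + q. x $ i * cnj (y $ i) * pairing p q (col g i) (col g i)) =
        (\<Sum>i<p + q. x $ i * cnj (y $ i) * of_real (sig p i))"
      by (rule sum.cong) (simp_all add: gram)
    then show ?thesis by (simp add: pairing_sig mult_ac)
  qed
  finally show ?thesis .
qed

lemma det_nonzero_inverse:
  fixes A :: "'a :: field mat"
  assumes A: "A \<in> carrier_mat n n" and det: "det A \<noteq> 0"
  obtains B where "B \<in> carrier_mat n n" "A * B = 1\<^sub>m n" "B * A = 1\<^sub>m n"
  using det_non_zero_imp_unit[OF A det, of "()"]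
  by (auto simp: Units_def ring_mat_def)

section \<open>The exponential of a diagonalizable matrix\<close>

lemma mat_diag_pow: "mat_diag n f ^\<^sub>m k = mat_diag n (\<lambda>i. f i ^ k)"
proof (induction k)
  case 0
  show ?case by (simp add: mat_diag_def one_mat_def)
next
  case (Suc k)
  then show ?case by (simp add: power_commutes)
qed

lemma conj_diag_nth:
  assumes "g \<in> carrier_mat n n" "h \<in> carrier_mat n n" "i < n" "j < n"
  shows "(g * mat_diag n f * h) $$ (i, j) = (\<Sum>l<n. g $$ (i, l) * f l * h $$ (l, j))"
  unfolding mat_diag_mult_right[OF assms(1)]
  using assms by (simp add: scalar_prod_def atLeast0LessThan)

lemma similar_mat_wit_carrier_diag:
  assumes "similar_mat_wit X (mat_diag n d) g h"
  shows "X \<in> carrier_mat n n"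
  using similar_mat_witD(4,5)[OF refl assms] by (metis carrier_matD(1) mat_diag_dim)

text \<open>Powers of \<open>X\<close> are conjugated powers of the diagonal matrix, so each entry
  series is a finite combination of scalar exponential series.\<close>

lemma mat_exp_conj_diag:
  assumes "similar_mat_wit X (mat_diag n d) g h"
  shows "mat_exp X = g * mat_diag n (\<lambda>i. exp (d i)) * h"
proof -
  have X: "X \<in> carrier_mat n n"
    by (rule similar_mat_wit_carrier_diag[OF assms])
  note gh = similar_mat_witD2(6,7)[OF X assms]
  have "(\<Sum>k. (X ^\<^sub>m k) $$ (i, j) / fact k) = (\<Sum>l<n. g $$ (i, l) * exp (d l) * h $$ (l, j))"
    if ij: "i < n" "j < n" for i j
  proof -
    have "(\<lambda>k. g $$ (i, l) * (d l ^ k /\<^sub>R fact k) * h $$ (l, j)) sums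
        (g $$ (i, l) * exp (d l) * h $$ (l, j))" for l
      by (intro sums_mult sums_mult2 exp_converges)
    then have "(\<lambda>k. \<Sum>l<n. g $$ (i, l) * (d l ^ k /\<^sub>R fact k) * h $$ (l, j)) sums
        (\<Sum>l<n. g $$ (i, l) * exp (d l) * h $$ (l, j))"
      by (intro sums_sum)
    moreover have "(X ^\<^sub>m k) $$ (i, j) / fact k =
        (\<Sum>l<n. g $$ (i, l) * (d l ^ k /\<^sub>R fact k) * h $$ (l, j))" for k
      unfolding similar_mat_wit_pow_id[OF assms] mat_diag_pow conj_diag_nth[OF gh ij]
      by (simp add: sum_divide_distrib sum_distrib_left scaleR_conv_of_real divide_inverse mult_ac)
    ultimately show ?thesis by (simp add: sums_iff)
  qed
  then show ?thesis
    using X gh by (intro eq_matI) (auto simp: mat_exp_def conj_diag_nth simp del: index_mult_mat(1))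
qed

section \<open>Eigenvectors under similarity and orthogonal eigenbases\<close>

lemma mult_mat_vec_zero:
  fixes A :: "'a :: semiring_1 mat"
  assumes "A \<in> carrier_mat n m"
  shows "A *\<^sub>v 0\<^sub>v m = 0\<^sub>v n"
  using assms by (intro eq_vecI) auto

text \<open>\<open>P\<close> intertwines \<open>B\<close> with \<open>A\<close>, and its left
  inverse \<open>Q\<close> keeps the image of \<open>v\<close> nonzero.\<close>

lemma similar_mat_wit_eigenvector:
  fixes A :: "'a :: field mat"
  assumes A: "A \<in> carrier_mat n n" and wit: "similar_mat_wit A B P Q"
    and ev: "eigenvector B v c"
  shows "eigenvector A (P *\<^sub>v v) c"
proof -
  note D = similar_mat_witD2[OF A wit]
  have v: "v \<in> carrier_vec n" "v \<noteq> 0\<^sub>v n" "B *\<^sub>v v = c \<cdot>\<^sub>v v"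
    using ev D(5) by (auto simp: eigenvector_def)
  have QPv: "Q *\<^sub>v (P *\<^sub>v v) = v"
    using assoc_mult_mat_vec[OF D(7,6) v(1)] v(1) by (simp add: D(2))
  have Pv: "P *\<^sub>v v \<in> carrier_vec n" using D(6) v(1) by simp
  have "P *\<^sub>v v \<noteq> 0\<^sub>v n"
  proof
    assume "P *\<^sub>v v = 0\<^sub>v n"
    then have "v = Q *\<^sub>v 0\<^sub>v n" using QPv by simp
    then show False using v(2) mult_mat_vec_zero[OF D(7)] by simp
  qed
  moreover have "A *\<^sub>v (P *\<^sub>v v) = c \<cdot>\<^sub>v (P *\<^sub>v v)"
  proof -
    have "A *\<^sub>v (P *\<^sub>v v) = P *\<^sub>v (B *\<^sub>v (Q *\<^sub>v (P *\<^sub>v v)))"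
      using assoc_mult_mat_vec[OF mult_carrier_mat[OF D(6,5)] D(7) Pv]
        assoc_mult_mat_vec[OF D(6,5), of "Q *\<^sub>v (P *\<^sub>v v)"] D(7) Pv
      by (simp add: D(3))
    then show ?thesis
      using mult_mat_vec[OF D(6) v(1)] by (simp add: QPv v(3))
  qed
  ultimately show ?thesis
    using A Pv by (simp add: eigenvector_def)
qed

text \<open>A Schur basis need not be adapted to the pairing. The pairing is therefore pulled back
  along \<open>P\<close> to a form \<open>F\<close> for which the triangular \<open>B\<close> is
  self-adjoint, which is why the triangular case treats an arbitrary Hermitian form.\<close>

lemma selfadjoint_orthogonal_eigenbasis:
  assumes M: "M \<in> carrier_mat (p + q) (p + q)" and self: "dagger p q M = M"
    and nonnull: "\<And>v c. eigenvector M v c \<Longrightarrow> pairing p q v v \<noteq> 0"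
  obtains u c where "\<And>i. i < p + q \<Longrightarrow> eigenvector M (u i) (c i)"
    "\<And>i j. i < p + q \<Longrightarrow> j < p + q \<Longrightarrow> i \<noteq> j \<Longrightarrow> pairing p q (u i) (u j) = 0"
proof -
  let ?n = "p + q"
  obtain as where "char_poly M = (\<Prod>a\<leftarrow>as. [:- a, 1:])"
    using char_poly_factorized[OF M] by blast
  from schur_decomposition_exists[OF M this]
  obtain B P Q where B: "B \<in> carrier_mat ?n ?n" "upper_triangular B"
    and wit: "similar_mat_wit M B P Q"
    by (auto simp: similar_mat_def)
  note D = similar_mat_witD2[OF M wit]
  have P: "P *\<^sub>v x \<in> carrier_vec ?n" if "x \<in> carrier_vec ?n" for x
    using D(6) that by simp
  have MP: "M *\<^sub>v (P *\<^sub>v x) = P *\<^sub>v (B *\<^sub>v x)" if x: "x \<in> carrier_vec ?n" for x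
  proof -
    have "M * P = P * B * (Q * P)"
      using assoc_mult_mat[OF mult_carrier_mat[OF D(6) B(1)] D(7,6)] D(3) by simp
    also have "\<dots> = P * B" using D(6) B(1) by (simp add: D(2))
    finally show ?thesis
      using assoc_mult_mat_vec[OF M D(6) x] assoc_mult_mat_vec[OF D(6) B(1) x] by simp
  qed
  define F where "F x y = pairing p q (P *\<^sub>v x) (P *\<^sub>v y)" for x y
  have "\<exists>v. (\<forall>i<?n. eigenvector B (v i) (B $$ (i, i))) \<and> (\<forall>i<?n. \<forall>j<?n. i \<noteq> j \<longrightarrow> F (v i) (v j) = 0)"
  proof (rule triangular_selfadjoint_eigenbasis[OF B])
    fix x y z :: "complex vec"
    assume "x \<in> carrier_vec ?n" "y \<in> carrier_vec ?n" "z \<in> carrier_vec ?n"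
    then show "F (x - y) z = F x z - F y z"
      using P by (simp add: F_def mult_minus_distrib_mat_vec[OF D(6)] pairing_diff_left)
  next
    fix a and x z :: "complex vec"
    assume "x \<in> carrier_vec ?n" "z \<in> carrier_vec ?n"
    then show "F (a \<cdot>\<^sub>v x) z = a * F x z"
      using P by (simp add: F_def mult_mat_vec[OF D(6)] pairing_smult_left)
  next
    fix x y :: "complex vec"
    show "F y x = cnj (F x y)" unfolding F_def by (rule pairing_commute)
  next
    fix x y :: "complex vec"
    assume "x \<in> carrier_vec ?n" "y \<in> carrier_vec ?n"
    then show "F (B *\<^sub>v x) y = F x (B *\<^sub>v y)"
      using self P unfolding F_def pairing_selfadjoint_iff[OF M] by (simp add: MP[symmetric])
  next
    fix v c
    assume "eigenvector B v c"
    then show "F v v \<noteq> 0"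
      unfolding F_def by (intro nonnull similar_mat_wit_eigenvector[OF M wit])
  qed
  then obtain v where "\<forall>i<?n. eigenvector B (v i) (B $$ (i, i))"
    and "\<forall>i<?n. \<forall>j<?n. i \<noteq> j \<longrightarrow> F (v i) (v j) = 0" by blast
  then show ?thesis
    by (intro that[of "\<lambda>i. P *\<^sub>v v i" "\<lambda>i. B $$ (i, i)"] similar_mat_wit_eigenvector[OF M wit])
       (simp_all add: F_def)
qed

text \<open>Column by column, \<open>eig\<close> says that \<open>M * g = g * mat_diag n c\<close>;
  the inverse of \<open>g\<close> does the rest.\<close>

lemma eigenbasis_similar_mat_wit:
  fixes M :: "'a :: field mat"
  assumes M: "M \<in> carrier_mat n n" and g: "g \<in> carrier_mat n n" "det g \<noteq> 0"
    and eig: "\<And>i. i < n \<Longrightarrow> M *\<^sub>v col g i = c i \<cdot>\<^sub>v col g i"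
  obtains h where "similar_mat_wit M (mat_diag n c) g h"
proof -
  obtain h where h: "h \<in> carrier_mat n n" "g * h = 1\<^sub>m n" "h * g = 1\<^sub>m n"
    using det_nonzero_inverse[OF g] .
  have "M * g = g * mat_diag n c"
    unfolding mat_diag_mult_right[OF g(1)]
  proof (rule eq_matI)
    fix i j assume "i < dim_row (mat n n (\<lambda>(i, j). g $$ (i, j) * c j))"
      "j < dim_col (mat n n (\<lambda>(i, j). g $$ (i, j) * c j))"
    then have ij: "i < n" "j < n" by auto
    have "(M * g) $$ (i, j) = (M *\<^sub>v col g j) $ i" using M g ij by simp
    then show "(M * g) $$ (i, j) = mat n n (\<lambda>(i, j). g $$ (i, j) * c j) $$ (i, j)"
      using eig[OF ij(2)] g ij by simp
  qed (use M g in auto)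
  then have "M = g * mat_diag n c * h"
    using assoc_mult_mat[OF M g(1) h(1)] M h(2) by simp
  then have "similar_mat_wit M (mat_diag n c) g h"
    by (rule similar_mat_witI[OF h(2,3) _ M mat_diag_dim g(1) h(1)])
  then show ?thesis by (rule that)
qed

section \<open>Diagonalization in the pseudo-unitary group\<close>

text \<open>By sesquilinearity, preservation of the pairing need only be checked on the
  columns.\<close>

lemma SU_I:
  assumes "g \<in> carrier_mat (p + q) (p + q)" "det g = 1"
    and "\<And>i j. i < p + q \<Longrightarrow> j < p + q \<Longrightarrow>
      pairing p q (col g i) (col g j) = (if i = j then of_real (sig p i) else 0)"
  shows "g \<in> SU p q"
  using assms pairing_preserved[OF assms(1,3)] by (auto simp: SU_def SL_def)

lemma SU_carrier: "g \<in> SU p q \<Longrightarrow> g \<in> carrier_mat (p + q) (p + q)"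
  by (simp add: SU_def SL_def)

lemma SU_pairing:
  assumes "g \<in> SU p q" "x \<in> carrier_vec (p + q)" "y \<in> carrier_vec (p + q)"
  shows "pairing p q (g *\<^sub>v x) (g *\<^sub>v y) = pairing p q x y"
  using assms by (simp add: SU_def)

lemma SU_gram:
  assumes g: "g \<in> SU p q" and ij: "i < p + q" "j < p + q"
  shows "pairing p q (col g i) (col g j) = (if i = j then of_real (sig p i) else 0)"
proof -
  have "pairing p q (col g i) (col g j) = pairing p q (unit_vec (p + q) i) (unit_vec (p + q) j)"
    using SU_pairing[OF g, of "unit_vec (p + q) i" "unit_vec (p + q) j"] ij
    by (simp add: mult_mat_vec_unit[OF SU_carrier[OF g]])
  then show ?thesis
    using ij by (simp only: pairing_unit_left) (auto simp: unit_vec_def)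
qed

text \<open>The normalized eigenbasis gives a matrix \<open>W\<close> whose determinant has modulus
  1. Rescaling its column 0 by a phase makes the determinant 1 and affects neither the Gram matrix
  nor the eigenvector property.\<close>

lemma pseudo_unitary_diagonalization:
  assumes pq: "0 < p + q" and M: "M \<in> carrier_mat (p + q) (p + q)" and self: "dagger p q M = M"
    and nonnull: "\<And>v c. eigenvector M v c \<Longrightarrow> pairing p q v v \<noteq> 0"
  obtains g h c where "g \<in> SU p q" "similar_mat_wit M (mat_diag (p + q) c) g h"
proof -
  let ?n = "p + q"
  obtain u c where ev: "\<And>i. i < ?n \<Longrightarrow> eigenvector M (u i) (c i)"
    and orth: "\<And>i j. i < ?n \<Longrightarrow> j < ?n \<Longrightarrow> i \<noteq> j \<Longrightarrow> pairing p q (u i) (u j) = 0"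
    using selfadjoint_orthogonal_eigenbasis[OF M self] nonnull by blast
  have u: "u i \<in> carrier_vec ?n" and Mu: "M *\<^sub>v u i = c i \<cdot>\<^sub>v u i" if "i < ?n" for i
    using ev[OF that] M by (auto simp: eigenvector_def)
  obtain \<pi> :: "nat \<Rightarrow> nat" and r :: "nat \<Rightarrow> complex"
    where \<pi>: "\<And>i. i < ?n \<Longrightarrow> \<pi> i < ?n"
    and gramW: "\<And>i j. i < ?n \<Longrightarrow> j < ?n \<Longrightarrow>
       pairing p q (r i \<cdot>\<^sub>v u (\<pi> i)) (r j \<cdot>\<^sub>v u (\<pi> j)) = (if i = j then of_real (sig p i) else 0)"
  proof (rule pseudo_orthonormal_reindex[of p q u])
    show "pairing p q (u i) (u i) \<noteq> 0" if "i < ?n" for i by (rule nonnull[OF ev[OF that]])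
  qed (use u orth that in auto)
  define W where "W = mat ?n ?n (\<lambda>(k, i). (r i \<cdot>\<^sub>v u (\<pi> i)) $ k)"
  have W: "W \<in> carrier_mat ?n ?n" by (simp add: W_def)
  have col_W: "col W i = r i \<cdot>\<^sub>v u (\<pi> i)" if "i < ?n" for i
    using that u[OF \<pi>[OF that]] by (auto simp: W_def)
  have detW: "det W * cnj (det W) = 1"
    by (rule pairing_preserved_det[OF W]) (simp add: col_W gramW)
  \<comment> \<open>The conjugate of \<open>det W\<close> is its inverse, so this phase corrects the
    determinant; \<open>0 < p + q\<close> provides the column 0.\<close>
  define z where "z i = (if i = 0 then cnj (det W) else 1)" for i :: nat
  have z: "z i * cnj (z i) = 1" for i
    using detW by (simp add: z_def mult.commute)
  define g where "g = W * mat_diag ?n z"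
  have g: "g \<in> carrier_mat ?n ?n" using W by (simp add: g_def)
  have "(\<Prod>i<?n. z i) = cnj (det W)"
    using pq by (simp add: z_def)
  then have det_g: "det g = 1"
    using detW by (simp add: g_def det_mult[OF W mat_diag_dim] det_mat_diag)
  have col_g: "col g i = (z i * r i) \<cdot>\<^sub>v u (\<pi> i)" if "i < ?n" for i
  proof -
    have "col g i = z i \<cdot>\<^sub>v col W i"
      using that W unfolding g_def mat_diag_mult_right[OF W] by (auto simp: mult.commute)
    then show ?thesis using that by (simp add: col_W smult_smult_assoc)
  qed
  have "g \<in> SU p q"
  proof (rule SU_I[OF g det_g])
    fix i j assume ij: "i < ?n" "j < ?n"
    have "pairing p q (col g i) (col g j) =
        z i * cnj (z j) * pairing p q (r i \<cdot>\<^sub>v u (\<pi> i)) (r j \<cdot>\<^sub>v u (\<pi> j))"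
      using ij u[OF \<pi>] by (simp add: col_g pairing_smult_left pairing_smult_right)
    then show "pairing p q (col g i) (col g j) = (if i = j then of_real (sig p i) else 0)"
      using ij by (simp add: gramW z)
  qed
  moreover obtain h where "similar_mat_wit M (mat_diag ?n (\<lambda>i. c (\<pi> i))) g h"
  proof (rule eigenbasis_similar_mat_wit[OF M g])
    show "det g \<noteq> 0" by (simp add: det_g)
    show "M *\<^sub>v col g i = c (\<pi> i) \<cdot>\<^sub>v col g i" if "i < ?n" for i
      using that u[OF \<pi>[OF that]]
      by (simp add: col_g mult_mat_vec[OF M] Mu \<pi> smult_smult_assoc mult.commute)
  qed
  ultimately show ?thesis by (rule that)
qed

lemma mat_diag_mult_vec_nth:
  assumes "y \<in> carrier_vec n" "i < n"
  shows "(mat_diag n f *\<^sub>v y) $ i = f i * y $ i"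
proof -
  have "mat_diag n f $$ (i, j) * y $ j = (if j = i then f i * y $ i else 0)" if "j < n" for j
    using that assms by (auto simp: mat_diag_def)
  then have "(\<Sum>j<n. mat_diag n f $$ (i, j) * y $ j) = (\<Sum>j<n. if j = i then f i * y $ i else 0)"
    by (intro sum.cong) simp_all
  then show ?thesis
    using assms(2) by (simp add: mult_mat_vec_nth[OF mat_diag_dim assms] del: index_mult_mat_vec)
qed

lemma mat_diag_eigenvector:
  fixes f :: "nat \<Rightarrow> 'a :: comm_ring_1"
  assumes "i < n"
  shows "eigenvector (mat_diag n f) (unit_vec n i) (f i)"
proof -
  have "col (mat_diag n f) i = f i \<cdot>\<^sub>v unit_vec n i"
    using assms by (intro eq_vecI) (auto simp: mat_diag_def unit_vec_def)
  then show ?thesis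
    using assms mult_mat_vec_unit[OF mat_diag_dim assms, of f] by (simp add: eigenvector_def mat_diag_def)
qed

lemma similar_mat_wit_mult_vec:
  assumes A: "A \<in> carrier_mat n n" and wit: "similar_mat_wit A B P Q" and x: "x \<in> carrier_vec n"
  shows "A *\<^sub>v x = P *\<^sub>v (B *\<^sub>v (Q *\<^sub>v x))" "P *\<^sub>v (Q *\<^sub>v x) = x"
proof -
  note D = similar_mat_witD2[OF A wit]
  have Qx: "Q *\<^sub>v x \<in> carrier_vec n" using D(7) x by simp
  show "A *\<^sub>v x = P *\<^sub>v (B *\<^sub>v (Q *\<^sub>v x))"
    using assoc_mult_mat_vec[OF mult_carrier_mat[OF D(6,5)] D(7) x] assoc_mult_mat_vec[OF D(6,5) Qx]
    by (simp add: D(3))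
  show "P *\<^sub>v (Q *\<^sub>v x) = x"
    using assoc_mult_mat_vec[OF D(6,7) x] x by (simp add: D(1))
qed

text \<open>A real diagonal matrix is self-adjoint for the diagonal form, and \<open>g\<close>
  transports this to \<open>X\<close>. It places the logarithm of \<open>s\<close> in
  \<open>q_space\<close>.\<close>

lemma similar_real_diag_selfadjoint:
  assumes g: "g \<in> SU p q" and wit: "similar_mat_wit X (mat_diag (p + q) (\<lambda>i. of_real (d i))) g h"
  shows "dagger p q X = X"
proof -
  let ?n = "p + q" and ?D = "mat_diag (p + q) (\<lambda>i. complex_of_real (d i))"
  have X: "X \<in> carrier_mat ?n ?n" by (rule similar_mat_wit_carrier_diag[OF wit])
  note W = similar_mat_witD2[OF X wit]
  show ?thesis
    unfolding pairing_selfadjoint_iff[OF X]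
  proof (intro ballI)
    fix x y :: "complex vec" assume x: "x \<in> carrier_vec ?n" and y: "y \<in> carrier_vec ?n"
    have h: "h *\<^sub>v x \<in> carrier_vec ?n" "h *\<^sub>v y \<in> carrier_vec ?n" using W(7) x y by auto
    then have Dh: "?D *\<^sub>v (h *\<^sub>v x) \<in> carrier_vec ?n" "?D *\<^sub>v (h *\<^sub>v y) \<in> carrier_vec ?n"
      using W(5) mult_mat_vec_carrier by blast+
    have "pairing p q (X *\<^sub>v x) y = pairing p q (g *\<^sub>v (?D *\<^sub>v (h *\<^sub>v x))) (g *\<^sub>v (h *\<^sub>v y))"
      by (simp only: similar_mat_wit_mult_vec(1)[OF X wit x] similar_mat_wit_mult_vec(2)[OF X wit y])
    also have "\<dots> = pairing p q (?D *\<^sub>v (h *\<^sub>v x)) (h *\<^sub>v y)"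
      by (rule SU_pairing[OF g Dh(1) h(2)])
    \<comment> \<open>Realness of \<open>d i\<close> lets the factor pass through the
      conjugation.\<close>
    also have "\<dots> = pairing p q (h *\<^sub>v x) (?D *\<^sub>v (h *\<^sub>v y))"
      unfolding pairing_sig
      by (rule sum.cong)
         (simp_all add: mat_diag_mult_vec_nth[OF h(1)] mat_diag_mult_vec_nth[OF h(2)] mult_ac
           del: index_mult_mat_vec)
    also have "\<dots> = pairing p q (g *\<^sub>v (h *\<^sub>v x)) (g *\<^sub>v (?D *\<^sub>v (h *\<^sub>v y)))"
      by (rule SU_pairing[OF g h(1) Dh(2), symmetric])
    also have "\<dots> = pairing p q x (X *\<^sub>v y)"
      by (simp only: similar_mat_wit_mult_vec(1)[OF X wit y] similar_mat_wit_mult_vec(2)[OF X wit x])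
    finally show "pairing p q (X *\<^sub>v x) y = pairing p q x (X *\<^sub>v y)" .
  qed
qed

text \<open>Cyclicity of the trace, written out as an exchange of sums followed by
  \<open>h * g = 1\<close>.\<close>

lemma trace_similar_diag:
  fixes X :: "'a :: comm_ring_1 mat"
  assumes wit: "similar_mat_wit X (mat_diag n d) g h"
  shows "(\<Sum>i<n. X $$ (i, i)) = (\<Sum>l<n. d l)"
proof -
  have X: "X \<in> carrier_mat n n" by (rule similar_mat_wit_carrier_diag[OF wit])
  note W = similar_mat_witD2[OF X wit]
  have "(\<Sum>i<n. X $$ (i, i)) = (\<Sum>i<n. \<Sum>l<n. d l * (h $$ (l, i) * g $$ (i, l)))"
    by (intro sum.cong refl) (simp add: W(3) conj_diag_nth[OF W(6,7)] mult_ac del: index_mult_mat(1))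
  also have "\<dots> = (\<Sum>l<n. d l * (\<Sum>i<n. h $$ (l, i) * g $$ (i, l)))"
    by (subst sum.swap) (simp add: sum_distrib_left)
  also have "\<dots> = (\<Sum>l<n. d l * (h * g) $$ (l, l))"
    using W(6,7) by (intro sum.cong refl) (simp add: scalar_prod_def atLeast0LessThan)
  also have "\<dots> = (\<Sum>l<n. d l)" by (simp add: W(2))
  finally show ?thesis .
qed

lemma similar_diag_eigenvalue:
  fixes A :: "'a :: field mat"
  assumes wit: "similar_mat_wit A (mat_diag n f) g h" and ev: "eigenvalue A c"
  obtains i where "i < n" "c = f i"
proof -
  have A: "A \<in> carrier_mat n n" by (rule similar_mat_wit_carrier_diag[OF wit])
  obtain v where "eigenvector A v c" using ev by (auto simp: eigenvalue_def)
  then have "eigenvector (mat_diag n f) (h *\<^sub>v v) c"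
    by (rule similar_mat_wit_eigenvector[OF mat_diag_dim similar_mat_wit_sym[OF wit]])
  then obtain y where y: "y \<in> carrier_vec n" "y \<noteq> 0\<^sub>v n" "mat_diag n f *\<^sub>v y = c \<cdot>\<^sub>v y"
    by (auto simp: eigenvector_def mat_diag_def)
  then obtain i where i: "i < n" "y $ i \<noteq> 0" by (auto simp: vec_eq_iff)
  have "f i * y $ i = c * y $ i"
    using arg_cong[OF y(3), of "\<lambda>v. v $ i"] i y(1) by (simp add: mat_diag_mult_vec_nth del: index_mult_mat_vec)
  then show ?thesis using i that by simp
qed

section \<open>Admissibility and the timelike cone\<close>

lemma admissible_diag_cone:
  fixes d :: "nat \<Rightarrow> real"
  assumes "p \<ge> 1" "q \<ge> 1" and gap: "\<And>i j. i < p \<Longrightarrow> p \<le> j \<Longrightarrow> j < p + q \<Longrightarrow> d j < d i"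
    and y: "y \<in> carrier_vec (p + q)" "y \<noteq> 0\<^sub>v (p + q)"
    and nonneg: "(\<Sum>i<p + q. sig p i * (cmod (y $ i))\<^sup>2) \<ge> 0"
  shows "(\<Sum>i<p + q. sig p i * (exp (d i) * cmod (y $ i))\<^sup>2) > 0"
proof -
  \<comment> \<open>\<open>p\<close> and \<open>q\<close> are positive, so both index sets are
    nonempty and the extrema are meaningful.\<close>
  have "Max (d ` {p..<p + q}) < Min (d ` {..<p})"
    using assms(1,2) gap by (simp add: lessThan_empty_iff)
  then obtain t where t: "Max (d ` {p..<p + q}) < t" "t < Min (d ` {..<p})"
    using dense by blast
  have pos: "t < d i" if "i < p" for i
    using t(2) that by (subst (asm) Min_gr_iff) auto
  have neg: "d j < t" if "p \<le> j" "j < p + q" for j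
    using t(1) that by (subst (asm) Max_less_iff) auto
  \<comment> \<open>For \<open>i < p\<close> both factors are positive, otherwise both are
    negative.\<close>
  have coeff: "sig p i * ((exp (d i))\<^sup>2 - (exp t)\<^sup>2) > 0" if "i < p + q" for i
    using pos[of i] neg[of i] that by (cases "i < p") (auto simp: power_strict_mono)
  obtain k where k: "k < p + q" "y $ k \<noteq> 0" using y by (auto simp: vec_eq_iff)
  have "(\<Sum>i<p + q. sig p i * ((exp (d i))\<^sup>2 - (exp t)\<^sup>2) * (cmod (y $ i))\<^sup>2) > 0"
  proof (rule sum_pos2)
    show "k \<in> {..<p + q}" using k by simp
    show "sig p k * ((exp (d k))\<^sup>2 - (exp t)\<^sup>2) * (cmod (y $ k))\<^sup>2 > 0"
      using k(2) by (intro mult_pos_pos[OF coeff[OF k(1)]]) simp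
    show "sig p i * ((exp (d i))\<^sup>2 - (exp t)\<^sup>2) * (cmod (y $ i))\<^sup>2 \<ge> 0" if "i \<in> {..<p + q}" for i
      using coeff[of i] that by (intro mult_nonneg_nonneg[OF less_imp_le]) simp_all
  qed simp
  also have "(\<Sum>i<p + q. sig p i * ((exp (d i))\<^sup>2 - (exp t)\<^sup>2) * (cmod (y $ i))\<^sup>2) =
      (\<Sum>i<p + q. sig p i * (exp (d i) * cmod (y $ i))\<^sup>2) -
      (exp t)\<^sup>2 * (\<Sum>i<p + q. sig p i * (cmod (y $ i))\<^sup>2)"
    by (simp add: sum_distrib_left sum_subtractf algebra_simps power_mult_distrib)
  finally show ?thesis
    using mult_nonneg_nonneg[OF _ nonneg, of "(exp t)\<^sup>2"] by simp
qed

text \<open>In the coordinates \<open>y = h x\<close> the matrix is diagonal and the pairing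
  unchanged, since \<open>g\<close> preserves it and \<open>g y = x\<close>.\<close>

lemma admissible_imp_cone_preserving:
  assumes pq: "p \<ge> 1" "q \<ge> 1" and gap: "\<And>i j. i < p \<Longrightarrow> p \<le> j \<Longrightarrow> j < p + q \<Longrightarrow> d j < d i"
    and g: "g \<in> SU p q" and wit: "similar_mat_wit s (mat_diag (p + q) (\<lambda>i. exp (complex_of_real (d i)))) g h"
    and x: "x \<in> timelike_cone p q \<union> nullcone p q"
  shows "s *\<^sub>v x \<in> timelike_cone p q \<union> {0\<^sub>v (p + q)}"
proof -
  let ?n = "p + q" and ?E = "mat_diag (p + q) (\<lambda>i. exp (complex_of_real (d i)))"
  have s: "s \<in> carrier_mat ?n ?n" by (rule similar_mat_wit_carrier_diag[OF wit])
  note W = similar_mat_witD2[OF s wit]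
  have xc: "x \<in> carrier_vec ?n" using x by (auto simp: timelike_cone_def nullcone_def)
  define y where "y = h *\<^sub>v x"
  have y: "y \<in> carrier_vec ?n" using W(7) xc by (simp add: y_def)
  have Ey: "?E *\<^sub>v y \<in> carrier_vec ?n" using W(5) y by (rule mult_mat_vec_carrier)
  have gy: "g *\<^sub>v y = x" unfolding y_def by (rule similar_mat_wit_mult_vec(2)[OF s wit xc])
  have sx: "s *\<^sub>v x = g *\<^sub>v (?E *\<^sub>v y)"
    unfolding y_def by (rule similar_mat_wit_mult_vec(1)[OF s wit xc])
  show ?thesis
  \<comment> \<open>The case \<open>y = 0\<close> accounts for the origin in the target set.\<close>
  proof (cases "y = 0\<^sub>v ?n")
    case True
    then have "x = 0\<^sub>v ?n" using gy mult_mat_vec_zero[OF W(6)] by simp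
    then show ?thesis using mult_mat_vec_zero[OF s] by simp
  next
    case False
    have "pairing p q x x = pairing p q y y"
      using SU_pairing[OF g y y] by (simp only: gy)
    moreover have "0 \<le> Re (pairing p q x x)"
      using x unfolding timelike_cone_def nullcone_def by (auto simp: less_complex_def)
    ultimately have "0 \<le> Re (pairing p q y y)" by simp
    then have nonneg: "(\<Sum>i<?n. sig p i * (cmod (y $ i))\<^sup>2) \<ge> 0"
      by (simp only: pairing_self Re_complex_of_real)
    have "(\<Sum>i<?n. sig p i * (exp (d i) * cmod (y $ i))\<^sup>2) > 0"
      by (rule admissible_diag_cone[OF pq _ y False nonneg]) (rule gap)
    moreover have "pairing p q (s *\<^sub>v x) (s *\<^sub>v x) =
        of_real (\<Sum>i<?n. sig p i * (exp (d i) * cmod (y $ i))\<^sup>2)"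
      unfolding sx SU_pairing[OF g Ey Ey] unfolding pairing_self of_real_eq_iff
      by (rule sum.cong)
         (simp_all add: mat_diag_mult_vec_nth[OF y] norm_mult del: index_mult_mat_vec)
    ultimately show ?thesis
      using s xc by (simp add: timelike_cone_def less_complex_def del: of_real_sum)
  qed
qed

lemma cone_preserving_eigenvector_nonnull:
  assumes s: "s \<in> carrier_mat (p + q) (p + q)" and ev: "eigenvector s v c" and c: "c \<noteq> 0"
    and cone: "(\<lambda>x. s *\<^sub>v x) ` (timelike_cone p q \<union> nullcone p q) \<subseteq> timelike_cone p q \<union> {0\<^sub>v (p + q)}"
  shows "pairing p q v v \<noteq> 0"
proof
  assume null: "pairing p q v v = 0"
  have v: "v \<in> carrier_vec (p + q)" "v \<noteq> 0\<^sub>v (p + q)" "s *\<^sub>v v = c \<cdot>\<^sub>v v"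
    using ev s by (auto simp: eigenvector_def)
  have "c \<cdot>\<^sub>v v \<in> timelike_cone p q \<union> {0\<^sub>v (p + q)}"
    using cone v null by (force simp: nullcone_def)
  moreover have "pairing p q (c \<cdot>\<^sub>v v) (c \<cdot>\<^sub>v v) = 0"
    using v null by (simp add: pairing_smult_left pairing_smult_right)
  ultimately have "c \<cdot>\<^sub>v v = 0\<^sub>v (p + q)" by (auto simp: timelike_cone_def)
  then show False using v c by (auto simp: vec_eq_iff)
qed

text \<open>Columns \<open>i\<close> and \<open>j\<close> of \<open>g\<close> have norms 1 and -1,
  so their sum is null, while its image has norm
  \<open>(c i)\<^sup>2 - (c j)\<^sup>2\<close>.\<close>

lemma cone_preserving_gap:
  assumes g: "g \<in> SU p q" and wit: "similar_mat_wit s (mat_diag (p + q) (\<lambda>i. complex_of_real (c i))) g h"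
    and pos: "\<And>i. i < p + q \<Longrightarrow> c i > 0"
    and cone: "(\<lambda>x. s *\<^sub>v x) ` (timelike_cone p q \<union> nullcone p q) \<subseteq> timelike_cone p q \<union> {0\<^sub>v (p + q)}"
    and ij: "i < p" "p \<le> j" "j < p + q"
  shows "c j < c i"
proof -
  let ?n = "p + q"
  have s: "s \<in> carrier_mat ?n ?n" by (rule similar_mat_wit_carrier_diag[OF wit])
  have gc: "g \<in> carrier_mat ?n ?n" by (rule SU_carrier[OF g])
  define v w where "v = col g i" and "w = col g j"
  have vw: "v \<in> carrier_vec ?n" "w \<in> carrier_vec ?n" using ij by (simp_all add: v_def w_def col_carrier_vec[OF _ gc])
  have gram: "pairing p q v v = 1" "pairing p q w w = - 1" "pairing p q v w = 0" "pairing p q w v = 0"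
    using ij by (auto simp: v_def w_def SU_gram[OF g])
  have eig: "s *\<^sub>v col g k = complex_of_real (c k) \<cdot>\<^sub>v col g k" if k: "k < ?n" for k
  proof -
    from similar_mat_wit_eigenvector[OF s wit mat_diag_eigenvector[OF k]] show ?thesis
      using k by (simp add: eigenvector_def mult_mat_vec_unit[OF gc])
  qed
  have sx: "s *\<^sub>v (v + w) = complex_of_real (c i) \<cdot>\<^sub>v v + complex_of_real (c j) \<cdot>\<^sub>v w"
    using eig[of i] eig[of j] ij
    unfolding mult_add_distrib_mat_vec[OF s vw] by (simp add: v_def w_def)
  have "v + w \<in> nullcone p q"
    using vw gram by (simp add: nullcone_def pairing_add_left pairing_add_right)
  then have mem: "s *\<^sub>v (v + w) \<in> timelike_cone p q \<union> {0\<^sub>v ?n}" using cone by blast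
  \<comment> \<open>Pairing with \<open>w\<close> yields \<open>- c j\<close>, which is nonzero and
    so rules out that the image is the origin.\<close>
  have "pairing p q (s *\<^sub>v (v + w)) w = - of_real (c j)"
    unfolding sx using vw gram by (simp add: pairing_add_left pairing_smult_left)
  moreover have "pairing p q (0\<^sub>v ?n) w = 0" by (simp add: pairing_sig)
  ultimately have "s *\<^sub>v (v + w) \<noteq> 0\<^sub>v ?n" using pos[of j] ij by auto
  with mem have "0 < pairing p q (s *\<^sub>v (v + w)) (s *\<^sub>v (v + w))"
    by (auto simp: timelike_cone_def)
  also have "pairing p q (s *\<^sub>v (v + w)) (s *\<^sub>v (v + w)) = of_real ((c i)\<^sup>2 - (c j)\<^sup>2)"
    unfolding sx using vw gram
    by (simp add: pairing_add_left pairing_add_right pairing_smult_left pairing_smult_right power2_eq_square)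
  finally have "(c j)\<^sup>2 < (c i)\<^sup>2" by (simp add: less_complex_def)
  then show ?thesis using pos[of i] ij by (simp add: power2_less_imp_less)
qed

theorem proposition4p4:
  fixes p q :: nat and s :: "complex mat"
  assumes "p \<ge> 1" and "q \<ge> 1" and "s \<in> Q_space p q"
  shows "s \<in> Q_adm p q \<longleftrightarrow>
    (\<forall>c. eigenvalue s c \<longrightarrow> c \<in> \<real> \<and> Re c > 0) \<and>
    (\<lambda>x. s *\<^sub>v x) ` (timelike_cone p q \<union> nullcone p q) \<subseteq> timelike_cone p q \<union> {0\<^sub>v (p + q)}"
proof
  let ?n = "p + q"
  assume "s \<in> Q_adm p q"
  then obtain X D g h where X: "s = mat_exp X" "D \<in> a_adm p q" "g \<in> SU p q" "similar_mat_wit X D g h"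
    by (auto simp: Q_adm_def q_adm_def)
  then obtain d where D: "D = mat_diag ?n (\<lambda>i. complex_of_real (d i))"
    by (auto simp: a_adm_def a_space_def)
  have gap: "d j < d i" if "i < p" "p \<le> j" "j < ?n" for i j
    using X(2) that by (auto simp: D a_adm_def mat_diag_def)
  have XD: "similar_mat_wit X (mat_diag ?n (\<lambda>i. complex_of_real (d i))) g h" using X(4) D by simp
  have Xc: "X \<in> carrier_mat ?n ?n" by (rule similar_mat_wit_carrier_diag[OF XD])
  note W = similar_mat_witD2[OF Xc XD]
  \<comment> \<open>Exponentiation keeps the conjugating pair \<open>g\<close>, \<open>h\<close>, so
    the eigenvalues of \<open>s\<close> are the \<open>exp (d i)\<close>.\<close>
  have wit: "similar_mat_wit s (mat_diag ?n (\<lambda>i. exp (complex_of_real (d i)))) g h"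
    unfolding X(1) mat_exp_conj_diag[OF XD]
    by (rule similar_mat_witI[OF W(1,2) refl _ mat_diag_dim W(6,7)])
       (intro mult_carrier_mat[of _ _ ?n] mat_diag_dim W(6,7))
  have "c \<in> \<real> \<and> Re c > 0" if "eigenvalue s c" for c
    using similar_diag_eigenvalue[OF wit that] by (metis Re_complex_of_real Reals_of_real exp_gt_zero exp_of_real)
  moreover have "s *\<^sub>v x \<in> timelike_cone p q \<union> {0\<^sub>v ?n}" if "x \<in> timelike_cone p q \<union> nullcone p q" for x
    by (rule admissible_imp_cone_preserving[OF assms(1,2) gap X(3) wit that])
  ultimately show "(\<forall>c. eigenvalue s c \<longrightarrow> c \<in> \<real> \<and> Re c > 0) \<and>
    (\<lambda>x. s *\<^sub>v x) ` (timelike_cone p q \<union> nullcone p q) \<subseteq> timelike_cone p q \<union> {0\<^sub>v (p + q)}"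
    by blast
next
  let ?n = "p + q"
  assume "(\<forall>c. eigenvalue s c \<longrightarrow> c \<in> \<real> \<and> Re c > 0) \<and>
    (\<lambda>x. s *\<^sub>v x) ` (timelike_cone p q \<union> nullcone p q) \<subseteq> timelike_cone p q \<union> {0\<^sub>v (p + q)}"
  then have real_pos: "\<And>c. eigenvalue s c \<Longrightarrow> c \<in> \<real> \<and> Re c > 0"
    and cone: "(\<lambda>x. s *\<^sub>v x) ` (timelike_cone p q \<union> nullcone p q) \<subseteq> timelike_cone p q \<union> {0\<^sub>v (p + q)}"
    by blast+
  have s: "s \<in> carrier_mat ?n ?n" "det s = 1" "dagger p q s = s"
    using assms(3) by (auto simp: Q_space_def SL_def)
  have nonnull: "pairing p q v v \<noteq> 0" if "eigenvector s v c" for v c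
  proof (rule cone_preserving_eigenvector_nonnull[OF s(1) that _ cone])
    have "eigenvalue s c" using that by (auto simp: eigenvalue_def)
    then show "c \<noteq> 0" using real_pos by fastforce
  qed
  have "0 < ?n" using assms(1) by simp
  then obtain g h c where g: "g \<in> SU p q" and wit: "similar_mat_wit s (mat_diag ?n c) g h"
    by (rule pseudo_unitary_diagonalization[OF _ s(1,3) nonnull])
  note W = similar_mat_witD2[OF s(1) wit]
  have c: "c i \<in> \<real> \<and> Re (c i) > 0" if i: "i < ?n" for i
  proof (rule real_pos)
    show "eigenvalue s (c i)"
      using similar_mat_wit_eigenvector[OF s(1) wit mat_diag_eigenvector[OF i]]
      unfolding eigenvalue_def by blast
  qed
  \<comment> \<open>The logarithm is meaningful for \<open>i < p + q\<close>, where
    \<open>c i\<close> is an eigenvalue and hence positive.\<close>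
  define d where "d i = ln (Re (c i))" for i
  have cd: "c i = of_real (exp (d i))" if "i < ?n" for i
    using c[OF that] by (auto simp: d_def elim!: Reals_cases)
  have "mat_diag ?n c = mat_diag ?n (\<lambda>i. complex_of_real (exp (d i)))"
    by (intro eq_matI) (auto simp: mat_diag_def cd)
  with wit have wit': "similar_mat_wit s (mat_diag ?n (\<lambda>i. complex_of_real (exp (d i)))) g h" by simp
  have "exp (d j) < exp (d i)" if "i < p" "p \<le> j" "j < ?n" for i j
    using cone_preserving_gap[OF g wit' _ cone that] by simp
  then have gap: "d j < d i" if "i < p" "p \<le> j" "j < ?n" for i j
    using that by simp
  \<comment> \<open>The condition \<open>det s = 1\<close> becomes vanishing of the sum of the
    logarithms, which makes \<open>X\<close> traceless.\<close>
  have "det s = det (mat_diag ?n (\<lambda>i. complex_of_real (exp (d i))))"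
    by (rule det_similar) (use wit' in \<open>auto simp: similar_mat_def\<close>)
  then have "complex_of_real (exp (\<Sum>i<?n. d i)) = 1"
    unfolding det_mat_diag s(2) by (simp add: exp_sum)
  then have sum_d: "(\<Sum>i<?n. d i) = 0" by (simp only: of_real_eq_1_iff exp_eq_one_iff)
  let ?D = "mat_diag ?n (\<lambda>i. complex_of_real (d i))"
  \<comment> \<open>A logarithm of \<open>s\<close>, diagonalized by the same
    \<open>g\<close>.\<close>
  define X where "X = g * ?D * h"
  have Xc: "X \<in> carrier_mat ?n ?n"
    unfolding X_def by (intro mult_carrier_mat[of _ _ ?n] mat_diag_dim W(6,7))
  have XD: "similar_mat_wit X ?D g h"
    by (rule similar_mat_witI[OF W(1,2) X_def Xc mat_diag_dim W(6,7)])
  have "(\<Sum>i<?n. X $$ (i, i)) = 0"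
    unfolding trace_similar_diag[OF XD] using sum_d by (simp flip: of_real_sum)
  then have "X \<in> q_space p q"
    using Xc similar_real_diag_selfadjoint[OF g XD] by (simp add: q_space_def sl_def atLeast0LessThan)
  moreover have "?D \<in> a_adm p q"
    using gap sum_d by (auto simp: a_adm_def a_space_def atLeast0LessThan) (auto simp: mat_diag_def)
  ultimately have "X \<in> q_adm p q"
    using g XD by (auto simp: q_adm_def)
  moreover have "s = mat_exp X"
    unfolding mat_exp_conj_diag[OF XD] using similar_mat_witD2(3)[OF s(1) wit'] by (simp add: exp_of_real)
  ultimately show "s \<in> Q_adm p q" by (auto simp: Q_adm_def)
qed

end
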